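(* Let $\mathcal{H}_A$ and $\mathcal{H}_B$ be finite-dimensional complex Hilbert spaces with $d_A=\dim\mathcal{H}_A>1$, let $\rho_A$ be a state on $\mathcal{H}_A$, and let $\mathcal{E}:\mathcal{L}(\mathcal{H}_A)\to\mathcal{L}(\mathcal{H}_B)$ be a quantum channel. Suppose that for every projective measurement $\{P_i\}$ on $\mathcal{H}_A$ and every projective measurement $\{Q_j\}$ on $\mathcal{H}_B$ the no-signalling in time (NSIT) condition $$\sum_i \operatorname{Tr}\big(\mathcal{E}(P_i\rho_A P_i)Q_j\big)=\operatorname{Tr}\big(\mathcal{E}(\rho_A)Q_j\big)\quad\text{for all } j$$ is satisfied. Then $\rho_A=I_A/d_A$ is maximally mixed, or $\mathcal{E}$ is a discard-and-prepare channel.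
   Context: $\mathcal{L}(\mathcal{H})$ denotes the algebra of linear operators on $\mathcal{H}$, and $I_A$ is the identity operator on $\mathcal{H}_A$. A state on $\mathcal{H}$ is a positive semidefinite operator of trace one (density operator). A quantum channel is a completely positive trace-preserving linear map. A projective measurement on $\mathcal{H}$ is a finite family $\{P_i\}$ of orthogonal (Hermitian) projections on $\mathcal{H}$, not necessarily of rank one, with $P_iP_j=\delta_{ij}P_i$ and $\sum_i P_i$ equal to the identity. A channel $\mathcal{E}:\mathcal{L}(\mathcal{H}_A)\to\mathcal{L}(\mathcal{H}_B)$ is a discard-and-prepare channel if there exists a state $\sigma_B$ on $\mathcal{H}_B$ such that $\mathcal{E}(\omega_A)=\sigma_B$ for all states $\omega_A$ on $\mathcal{H}_A$. *)

theory Defs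
  imports "Jordan_Normal_Form.Schur_Decomposition"
begin

text \<open>
  A Hilbert space of dimension \<open>d\<close> is \<open>\<complex>\<^sup>d\<close> with its standard inner product, and its operators are
  the matrices in \<open>carrier_mat d d\<close>. A superoperator is a HOL function on matrices of which only the
  values on that carrier matter.
\<close>

definition mat_trace :: "complex mat \<Rightarrow> complex" where
  "mat_trace A = (\<Sum>i<dim_row A. A $$ (i, i))"

definition hermitian_mat :: "nat \<Rightarrow> complex mat \<Rightarrow> bool" where
  "hermitian_mat d A \<longleftrightarrow> A \<in> carrier_mat d d \<and> mat_adjoint A = A"

text \<open>The order on \<open>complex\<close> is that of \<open>Complex_Order\<close>: \<open>0 \<le> z\<close> means that \<open>z\<close> is real and nonnegative.\<close>

definition psd_mat :: "nat \<Rightarrow> complex mat \<Rightarrow> bool" where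
  "psd_mat d A \<longleftrightarrow> hermitian_mat d A \<and> (\<forall>v \<in> carrier_vec d. 0 \<le> (A *\<^sub>v v) \<bullet>c v)"

definition state :: "nat \<Rightarrow> complex mat \<Rightarrow> bool" where
  "state d \<rho> \<longleftrightarrow> psd_mat d \<rho> \<and> mat_trace \<rho> = 1"

definition linear_superop :: "nat \<Rightarrow> nat \<Rightarrow> (complex mat \<Rightarrow> complex mat) \<Rightarrow> bool" where
  "linear_superop dA dB E \<longleftrightarrow>
     (\<forall>X \<in> carrier_mat dA dA. E X \<in> carrier_mat dB dB) \<and>
     (\<forall>X \<in> carrier_mat dA dA. \<forall>Y \<in> carrier_mat dA dA. E (X + Y) = E X + E Y) \<and>
     (\<forall>c. \<forall>X \<in> carrier_mat dA dA. E (c \<cdot>\<^sub>m X) = c \<cdot>\<^sub>m E X)"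

text \<open>
  An operator on \<open>\<complex>\<^sup>k \<otimes> \<complex>\<^sup>d\<close> is a \<open>k \<times> k\<close> block matrix with \<open>d \<times> d\<close> blocks: the basis vector
  \<open>e\<^sub>i \<otimes> e\<^sub>p\<close> has index \<open>i * d + p\<close>. The map \<open>id\<^sub>k \<otimes> E\<close> applies \<open>E\<close> to every block.
\<close>

definition mat_block :: "nat \<Rightarrow> complex mat \<Rightarrow> nat \<Rightarrow> nat \<Rightarrow> complex mat" where
  "mat_block d X i j = mat d d (\<lambda>(p, q). X $$ (i * d + p, j * d + q))"

definition id_tensor ::
  "nat \<Rightarrow> nat \<Rightarrow> nat \<Rightarrow> (complex mat \<Rightarrow> complex mat) \<Rightarrow> complex mat \<Rightarrow> complex mat" where
  "id_tensor k dA dB E X =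
     mat (k * dB) (k * dB)
       (\<lambda>(r, c). E (mat_block dA X (r div dB) (c div dB)) $$ (r mod dB, c mod dB))"

definition completely_positive :: "nat \<Rightarrow> nat \<Rightarrow> (complex mat \<Rightarrow> complex mat) \<Rightarrow> bool" where
  "completely_positive dA dB E \<longleftrightarrow>
     (\<forall>k X. psd_mat (k * dA) X \<longrightarrow> psd_mat (k * dB) (id_tensor k dA dB E X))"

definition trace_preserving :: "nat \<Rightarrow> (complex mat \<Rightarrow> complex mat) \<Rightarrow> bool" where
  "trace_preserving dA E \<longleftrightarrow> (\<forall>X \<in> carrier_mat dA dA. mat_trace (E X) = mat_trace X)"

definition quantum_channel :: "nat \<Rightarrow> nat \<Rightarrow> (complex mat \<Rightarrow> complex mat) \<Rightarrow> bool" where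
  "quantum_channel dA dB E \<longleftrightarrow>
     linear_superop dA dB E \<and> completely_positive dA dB E \<and> trace_preserving dA E"

text \<open>The finite family is \<open>P 0, \<dots>, P (m - 1)\<close>; zero projections are allowed.\<close>

definition projective_measurement :: "nat \<Rightarrow> nat \<Rightarrow> (nat \<Rightarrow> complex mat) \<Rightarrow> bool" where
  "projective_measurement d m P \<longleftrightarrow>
     (\<forall>i<m. hermitian_mat d (P i)) \<and>
     (\<forall>i<m. \<forall>j<m. P i * P j = (if i = j then P i else 0\<^sub>m d d)) \<and>
     mat d d (\<lambda>(r, c). \<Sum>i<m. P i $$ (r, c)) = 1\<^sub>m d"

definition nsit ::
  "complex mat \<Rightarrow> (complex mat \<Rightarrow> complex mat) \<Rightarrow> nat \<Rightarrow> (nat \<Rightarrow> complex mat) \<Rightarrow>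
   nat \<Rightarrow> (nat \<Rightarrow> complex mat) \<Rightarrow> bool" where
  "nsit \<rho> E m P n Q \<longleftrightarrow>
     (\<forall>j<n. (\<Sum>i<m. mat_trace (E (P i * \<rho> * P i) * Q j)) = mat_trace (E \<rho> * Q j))"

definition discard_and_prepare :: "nat \<Rightarrow> nat \<Rightarrow> (complex mat \<Rightarrow> complex mat) \<Rightarrow> bool" where
  "discard_and_prepare dA dB E \<longleftrightarrow>
     quantum_channel dA dB E \<and> (\<exists>\<sigma>. state dB \<sigma> \<and> (\<forall>\<omega>. state dA \<omega> \<longrightarrow> E \<omega> = \<sigma>))"

end

theory Submission
  imports Defs
begin

text \<open>
  Testing the two-outcome measurement of a ray \<open>v\<close> against a rank-one projection turns NSIT into
  \<open>2 \<langle>v, \<rho> v\<rangle> f(|v\<rangle>\<langle>v|) = \<langle>v, v\<rangle> f(|v\<rangle>\<langle>v| \<rho> + \<rho> |v\<rangle>\<langle>v|)\<close>, where \<open>f\<close> is a linear functional \<open>X \<mapsto> \<langle>w, E(X) w\<rangle>\<close>.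
  Polarisation gives \<open>\<langle>y, \<rho> x\<rangle> f(|x\<rangle>\<langle>y|) = 0\<close> whenever \<open>x\<close> and \<open>y\<close> are orthogonal. For each \<open>x\<close>,
  one of two linear functionals therefore vanishes on the orthogonal complement of \<open>x\<close>; as this is
  a polynomial condition on \<open>x\<close>, the same one vanishes for all \<open>x\<close>. Hence either \<open>\<rho>\<close> is scalar, or
  every \<open>f\<close> is a multiple of the trace, which makes \<open>E\<close> constant on states.
\<close>

section \<open>Sesquilinear forms and polarisation\<close>

text \<open>
  Vectors of \<open>\<complex>\<^sup>d\<close> are functions \<open>nat \<Rightarrow> complex\<close> of which only the values below \<open>d\<close> matter. Forms are
  antilinear in the first argument.
\<close>

definition sesquilinear :: "((nat \<Rightarrow> complex) \<Rightarrow> (nat \<Rightarrow> complex) \<Rightarrow> complex) \<Rightarrow> bool" where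
  "sesquilinear B \<longleftrightarrow>
     (\<forall>a b x y z. B z (\<lambda>i. a * x i + b * y i) = a * B z x + b * B z y) \<and>
     (\<forall>a b x y z. B (\<lambda>i. a * x i + b * y i) z = cnj a * B x z + cnj b * B y z)"

lemma sesquilinear_right:
  "sesquilinear B \<Longrightarrow> B z (\<lambda>i. a * x i + b * y i) = a * B z x + b * B z y"
  by (simp add: sesquilinear_def)

lemma sesquilinear_left:
  "sesquilinear B \<Longrightarrow> B (\<lambda>i. a * x i + b * y i) z = cnj a * B x z + cnj b * B y z"
  by (simp add: sesquilinear_def)

lemma sesquilinear_expand:
  assumes "sesquilinear B"
  shows "B (\<lambda>i. 1 * x i + s * y i) (\<lambda>i. 1 * x i + s * y i) =
    B x x + s * B x y + cnj s * B y x + s * cnj s * B y y"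
  by (simp only: sesquilinear_left[OF assms] sesquilinear_right[OF assms])
     (simp add: algebra_simps)

text \<open>
  On the circle \<open>\<bar>s\<bar> = 1\<close> the fourth roots of unity isolate the coefficients of \<open>s\<^sup>2\<close> and of
  \<open>(cnj s)\<^sup>2\<close>, but only their sum.
\<close>

lemma polarize_fourth_roots:
  fixes a :: complex
  assumes h: "\<And>s. 2 * (a + s * b + cnj s * c + s * cnj s * e) * (a' + s * b' + cnj s * c' + s * cnj s * e')
     = (g + s * h + cnj s * k + s * cnj s * l) * (g' + s * h' + cnj s * k' + s * cnj s * l')"
  shows "2 * c * c' - k * k' + (2 * b * b' - h * h') = 0"
proof -
  define p where "p = (\<lambda>s. 2 * (a + s * b + cnj s * c + s * cnj s * e) * (a' + s * b' + cnj s * c' + s * cnj s * e')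
     - (g + s * h + cnj s * k + s * cnj s * l) * (g' + s * h' + cnj s * k' + s * cnj s * l'))"
  have ii: "\<i> * (\<i> * z) = - z" for z by (simp flip: mult.assoc)
  \<comment> \<open>The weights 1, 1, -1, -1 are the values of s^2 at these four points, so the
    monomials 1, s and \<open>cnj s\<close> cancel.\<close>
  have "p 1 + p (-1) - p \<i> - p (-\<i>) = 4 * (2 * c * c' - k * k' + (2 * b * b' - h * h'))"
    unfolding p_def by (simp add: algebra_simps ii)
  moreover have "p s = 0" for s using h[of s] by (simp add: p_def)
  ultimately show ?thesis by (metis add_0 diff_0_right mult_eq_0_iff zero_neq_numeral)
qed

text \<open>Along v = x + s y both sides are polynomials in s and \<open>cnj s\<close>. In the
  coefficient of \<open>(cnj s)^2\<close> every first argument is y and every second argument is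
  x.\<close>

lemma sesquilinear_polarize:
  assumes R: "sesquilinear R" and M: "sesquilinear M" and G: "sesquilinear G" and N: "sesquilinear N"
    and h: "\<And>v. 2 * R v v * M v v = G v v * N v v"
  shows "2 * R y x * M y x = G y x * N y x"
proof -
  define D where "D = (\<lambda>y x. 2 * R y x * M y x - G y x * N y x)"
  have sum0: "D y x + D x y = 0" for x y
    unfolding D_def
    by (rule polarize_fourth_roots[where a = "R x x" and e = "R y y" and a' = "M x x" and e' = "M y y"
          and g = "G x x" and l = "G y y" and g' = "N x x" and l' = "N y y"])
       (use h[of "\<lambda>i. 1 * x i + _ * y i"] in \<open>simp only: sesquilinear_expand[OF R] sesquilinear_expand[OF M]
        sesquilinear_expand[OF G] sesquilinear_expand[OF N]\<close>)
  \<comment> \<open>Rotating \<open>y\<close> by an eighth of a turn separates the two terms of the sum.\<close>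
  define w where "w = (\<lambda>i. (1 + \<i>) * y i + 0 * y i)"
  have w: "B w x = (1 - \<i>) * B y x" "B x w = (1 + \<i>) * B x y" if "sesquilinear B" for B
    unfolding w_def sesquilinear_left[OF that] sesquilinear_right[OF that] by simp_all
  have "D w x = -2 * \<i> * D y x" "D x w = 2 * \<i> * D x y"
    unfolding D_def w[OF R] w[OF M] w[OF G] w[OF N] by (simp_all add: algebra_simps)
  with sum0[of w x] have "2 * \<i> * (D x y - D y x) = 0" by (simp add: algebra_simps)
  then have "D x y = D y x" by simp
  with sum0[of y x] have "D y x = 0" by simp
  then show ?thesis by (simp add: D_def)
qed

section \<open>Proportional functionals: from orthogonality to a global dichotomy\<close>

text \<open>Phrasing proportionality by \<open>2 \<times> 2\<close> minors makes it a polynomial condition on \<open>x\<close>.\<close>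

definition proportional_at ::
  "((nat \<Rightarrow> complex) \<Rightarrow> (nat \<Rightarrow> complex) \<Rightarrow> complex) \<Rightarrow>
   ((nat \<Rightarrow> complex) \<Rightarrow> (nat \<Rightarrow> complex) \<Rightarrow> complex) \<Rightarrow> (nat \<Rightarrow> complex) \<Rightarrow> bool" where
  "proportional_at B G x \<longleftrightarrow> (\<forall>y z. B y x * G z x = B z x * G y x)"

text \<open>A functional that vanishes on the kernel of another is a multiple of it; the vector
  \<open>?u\<close> is the combination of y and z that lies in the kernel of
  \<open>G _ x\<close>.\<close>

lemma proportional_at_if_orthogonal:
  assumes B: "sesquilinear B" and G: "sesquilinear G"
    and h: "\<And>y. G y x = 0 \<Longrightarrow> B y x = 0"
  shows "proportional_at B G x"
  unfolding proportional_at_def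
proof (intro allI)
  fix y z
  let ?u = "\<lambda>i. cnj (G z x) * y i + - cnj (G y x) * z i"
  have "B ?u x = 0"
    by (rule h) (simp only: sesquilinear_left[OF G], simp)
  then show "B y x * G z x = B z x * G y x"
    by (simp only: sesquilinear_left[OF B]) (simp add: mult.commute)
qed

text \<open>The kernel of \<open>G _ x\<close> is not a union of two proper subspaces: if y escapes
  the kernel of \<open>R _ x\<close> and z that of \<open>M _ x\<close>, then y + z escapes
  both.\<close>

lemma pointwise_proportional:
  assumes R: "sesquilinear R" and M: "sesquilinear M" and G: "sesquilinear G"
    and h: "\<And>y. G y x = 0 \<Longrightarrow> R y x * M y x = 0"
  shows "proportional_at R G x \<or> proportional_at M G x"
proof (rule ccontr)
  assume "\<not> ?thesis"
  then obtain y z where y: "G y x = 0" "R y x \<noteq> 0" and z: "G z x = 0" "M z x \<noteq> 0"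
    using proportional_at_if_orthogonal[OF R G] proportional_at_if_orthogonal[OF M G] by meson
  let ?u = "\<lambda>i. 1 * y i + 1 * z i"
  have "G ?u x = 0" by (simp only: sesquilinear_left[OF G] y z) simp
  then have "(R y x + R z x) * (M y x + M z x) = 0"
    using h[of ?u] by (simp only: sesquilinear_left[OF R] sesquilinear_left[OF M]) simp
  with h[OF y(1)] h[OF z(1)] y z show False by auto
qed

text \<open>Suppose a minor of R is nonzero at x and a minor of M at y. Along the line x + t y both
  become polynomials in t whose product has every t as a root, so one of them is the zero
  polynomial.\<close>

lemma globally_proportional:
  assumes R: "sesquilinear R" and M: "sesquilinear M" and G: "sesquilinear G"
    and h: "\<And>x. proportional_at R G x \<or> proportional_at M G x"
  shows "(\<forall>x. proportional_at R G x) \<or> (\<forall>x. proportional_at M G x)"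
proof (rule ccontr)
  assume "\<not> ?thesis"
  then obtain x y a b c e where x: "R a x * G b x \<noteq> R b x * G a x"
    and y: "M c y * G e y \<noteq> M e y * G c y"
    unfolding proportional_at_def by blast
  \<comment> \<open>The minors along the line \<open>x + t y\<close>, as polynomials in \<open>t\<close>.\<close>
  define p where "p = (\<lambda>B a b. [:B a x, B a y:] * [:G b x, G b y:] - [:B b x, B b y:] * [:G a x, G a y:])"
  have poly_p: "poly (p B a b) t = 0"
    if "sesquilinear B" "proportional_at B G (\<lambda>i. 1 * x i + t * y i)" for B a b t
    using that(2) unfolding proportional_at_def sesquilinear_right[OF that(1)] sesquilinear_right[OF G]
    by (simp add: p_def algebra_simps)
  have "poly (p R a b * p M c e) t = 0" for t
    using h[of "\<lambda>i. 1 * x i + t * y i"] poly_p[OF R] poly_p[OF M] by auto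
  then have "p R a b = 0 \<or> p M c e = 0"
    by (metis poly_all_0_iff_0 mult_eq_0_iff)
  then show False
  proof
    assume "p R a b = 0"
    \<comment> \<open>The constant coefficient is the minor of R at x.\<close>
    then have "coeff (p R a b) 0 = 0" by simp
    with x show False by (simp add: p_def mult.commute)
  next
    assume "p M c e = 0"
    \<comment> \<open>The coefficient of t^2 is the minor of M at y, the point at infinity of the
      line.\<close>
    then have "coeff (p M c e) 2 = 0" by simp
    with y show False by (simp add: p_def numeral_2_eq_2 mult.commute)
  qed
qed

section \<open>Inner product, rank-one operators and matrix entries\<close>

definition sdot :: "nat \<Rightarrow> (nat \<Rightarrow> complex) \<Rightarrow> (nat \<Rightarrow> complex) \<Rightarrow> complex" where
  "sdot d w v = (\<Sum>i<d. cnj (w i) * v i)"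

definition app :: "nat \<Rightarrow> complex mat \<Rightarrow> (nat \<Rightarrow> complex) \<Rightarrow> nat \<Rightarrow> complex" where
  "app d A v = (\<lambda>i. \<Sum>j<d. A $$ (i, j) * v j)"

definition outer :: "nat \<Rightarrow> (nat \<Rightarrow> complex) \<Rightarrow> (nat \<Rightarrow> complex) \<Rightarrow> complex mat" where
  "outer d v w = mat d d (\<lambda>(i, j). v i * cnj (w j))"

definition unit_fun :: "nat \<Rightarrow> nat \<Rightarrow> complex" where
  "unit_fun i = (\<lambda>j. if j = i then 1 else 0)"

lemma outer_carrier [simp]: "outer d v w \<in> carrier_mat d d"
  by (simp add: outer_def)

lemma sesquilinear_sdot: "sesquilinear (sdot d)"
  by (simp add: sesquilinear_def sdot_def sum.distrib sum_distrib_left algebra_simps)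

lemma app_linear: "app d A (\<lambda>i. a * x i + b * y i) = (\<lambda>i. a * app d A x i + b * app d A y i)"
  by (simp add: app_def sum.distrib sum_distrib_left algebra_simps)

lemma sesquilinear_sdot_app: "sesquilinear (\<lambda>w v. sdot d w (app d A v))"
  using sesquilinear_sdot[of d] by (simp add: sesquilinear_def app_linear)

lemma sdot_self_eq_0:
  assumes "sdot d v v = 0" "i < d" shows "v i = 0"
proof -
  have "sdot d v v = of_real (\<Sum>i<d. (cmod (v i))\<^sup>2)"
    unfolding sdot_def by (simp add: complex_norm_square mult.commute del: of_real_power)
  with assms(1) have "(\<Sum>i<d. (cmod (v i))\<^sup>2) = 0" by (metis of_real_eq_0_iff)
  with assms(2) show ?thesis by (simp add: sum_nonneg_eq_0_iff)
qed

lemma mult_outer: "A \<in> carrier_mat d d \<Longrightarrow> A * outer d v w = outer d (app d A v) w"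
  by (rule eq_matI) (auto simp: outer_def app_def scalar_prod_def sum_distrib_right atLeast0LessThan
      mult.assoc intro!: sum.cong)

lemma outer_mult_outer: "outer d a b * outer d v w = sdot d b v \<cdot>\<^sub>m outer d a w"
  by (rule eq_matI) (auto simp: outer_def sdot_def scalar_prod_def sum_distrib_left atLeast0LessThan
      mult_ac intro!: sum.cong)

lemma sdot_unit:
  "i < d \<Longrightarrow> sdot d (unit_fun i) v = v i"
  by (simp add: sdot_def unit_fun_def if_distrib[of cnj] if_distrib[of "\<lambda>z. z * _"] cong: if_cong)

lemma app_unit: "j < d \<Longrightarrow> app d A (unit_fun j) i = A $$ (i, j)"
  by (simp add: app_def unit_fun_def if_distrib[of "\<lambda>z. _ * z"] cong: if_cong)

text \<open>Testing at a basis vector kills the off-diagonal entries; testing at the sum of two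
  basis vectors equates their diagonal entries.\<close>

lemma proportional_sdot_imp_scalar:
  assumes B: "sesquilinear B" and h: "\<And>x. proportional_at B (sdot d) x"
    and ij: "i < d" "j < d"
  shows "B (unit_fun i) (unit_fun j) = (if i = j then B (unit_fun 0) (unit_fun 0) else 0)"
proof -
  let ?e = unit_fun
  have off: "B (?e i) (?e j) = 0" if "i < d" "j < d" "i \<noteq> j" for i j
    using h[of "?e j", unfolded proportional_at_def, rule_format, of "?e i" "?e j"] that
    by (simp add: sdot_unit) (simp add: unit_fun_def)
  have diag: "B (?e i) (?e i) = B (?e j) (?e j)" if "i < d" "j < d" for i j
  proof (cases "i = j")
    case False
    let ?x = "\<lambda>k. 1 * ?e i k + 1 * ?e j k"
    have x: "sdot d (?e i) ?x = 1" "sdot d (?e j) ?x = 1"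
      using that False by (simp_all add: sdot_unit) (simp_all add: unit_fun_def)
    have "B (?e i) ?x = B (?e j) ?x"
      using h[of ?x, unfolded proportional_at_def, rule_format, of "?e i" "?e j"]
      unfolding x by simp
    then show ?thesis
      unfolding sesquilinear_right[OF B] using off that False by simp
  qed simp
  show ?thesis
    using off ij diag[of i 0] by auto
qed

text \<open>Expanding at x + y and x + i y recovers the sum and the difference of the two mixed
  terms.\<close>

lemma sesquilinear_eqI:
  assumes A: "sesquilinear A" and B: "sesquilinear B" and h: "\<And>v. A v v = B v v"
  shows "A y x = B y x"
proof -
  have "A x y + A y x = B x y + B y x"
    using h[of "\<lambda>i. 1 * x i + 1 * y i"] h[of x] h[of y]
    unfolding sesquilinear_expand[OF A] sesquilinear_expand[OF B] by simp
  moreover have "\<i> * (A x y - A y x) = \<i> * (B x y - B y x)"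
    using h[of "\<lambda>i. 1 * x i + \<i> * y i"] h[of x] h[of y]
    unfolding sesquilinear_expand[OF A] sesquilinear_expand[OF B] by (simp add: algebra_simps)
  then have "A x y - A y x = B x y - B y x" by simp
  ultimately have "(A x y + A y x) - (A x y - A y x) = (B x y + B y x) - (B x y - B y x)"
    by (simp only:)
  then show ?thesis by simp
qed

text \<open>Lets the equality of two channel outputs be checked on the values \<langle>w, E(X)
  w\<rangle> alone.\<close>

lemma mat_eq_if_quadratic_forms_eq:
  assumes "A \<in> carrier_mat d d" "B \<in> carrier_mat d d"
    and "\<And>v. sdot d v (app d A v) = sdot d v (app d B v)"
  shows "A = B"
proof (rule eq_matI)
  fix i j assume "i < dim_row B" "j < dim_col B"
  then have ij: "i < d" "j < d" using assms by auto
  have "sdot d (unit_fun i) (app d A (unit_fun j)) = sdot d (unit_fun i) (app d B (unit_fun j))"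
    by (rule sesquilinear_eqI[OF sesquilinear_sdot_app[of d A] sesquilinear_sdot_app[of d B]])
       (rule assms(3))
  then show "A $$ (i, j) = B $$ (i, j)"
    using ij by (simp add: sdot_unit app_unit)
qed (use assms in auto)

section \<open>Linear functionals on matrices\<close>

definition linear_functional :: "nat \<Rightarrow> (complex mat \<Rightarrow> complex) \<Rightarrow> bool" where
  "linear_functional d f \<longleftrightarrow>
     (\<forall>a b. \<forall>X \<in> carrier_mat d d. \<forall>Y \<in> carrier_mat d d.
        f (a \<cdot>\<^sub>m X + b \<cdot>\<^sub>m Y) = a * f X + b * f Y)"

lemma linear_functionalD:
  assumes "linear_functional d f" "X \<in> carrier_mat d d" "Y \<in> carrier_mat d d"
  shows "f (a \<cdot>\<^sub>m X + b \<cdot>\<^sub>m Y) = a * f X + b * f Y"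
  using assms by (simp add: linear_functional_def)

lemma linear_functional_minus:
  assumes "linear_functional d f" "X \<in> carrier_mat d d" "Y \<in> carrier_mat d d"
  shows "f (X - Y) = f X - f Y"
proof -
  have "X - Y = 1 \<cdot>\<^sub>m X + (-1) \<cdot>\<^sub>m Y" using assms by (intro eq_matI) auto
  then show ?thesis using linear_functionalD[OF assms, of 1 "-1"] by simp
qed

lemma linear_functional_smult:
  assumes "linear_functional d f" "X \<in> carrier_mat d d"
  shows "f (a \<cdot>\<^sub>m X) = a * f X"
proof -
  have "a \<cdot>\<^sub>m X = a \<cdot>\<^sub>m X + 0 \<cdot>\<^sub>m X" using assms by (intro eq_matI) auto
  then show ?thesis using linear_functionalD[OF assms assms(2), of a 0] by simp
qed

text \<open>The combination is formed entrywise because a zero matrix is tied to its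
  dimension.\<close>

lemma linear_functional_sum:
  assumes f: "linear_functional d f" and S: "finite S" and X: "\<And>k. k \<in> S \<Longrightarrow> X k \<in> carrier_mat d d"
  shows "f (mat d d (\<lambda>(r, c). \<Sum>k\<in>S. a k * X k $$ (r, c))) = (\<Sum>k\<in>S. a k * f (X k))"
  using S X
proof (induction S)
  case empty
  have "f (0 \<cdot>\<^sub>m 0\<^sub>m d d) = 0" by (simp only: linear_functional_smult[OF f zero_carrier_mat] mult_zero_left)
  moreover have "(0::complex) \<cdot>\<^sub>m 0\<^sub>m d d = mat d d (\<lambda>(r, c). 0)" by (rule eq_matI) auto
  ultimately show ?case by (simp only: sum.empty)
next
  case (insert k S)
  let ?Y = "mat d d (\<lambda>(r, c). \<Sum>k\<in>S. a k * X k $$ (r, c))"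
  have "mat d d (\<lambda>(r, c). \<Sum>k\<in>insert k S. a k * X k $$ (r, c)) = a k \<cdot>\<^sub>m X k + 1 \<cdot>\<^sub>m ?Y"
    using insert.hyps insert.prems[of k] by (intro eq_matI) auto
  then have "f (mat d d (\<lambda>(r, c). \<Sum>k\<in>insert k S. a k * X k $$ (r, c))) = a k * f (X k) + 1 * f ?Y"
    using insert.prems by (simp only:) (rule linear_functionalD[OF f]; simp)
  also have "f ?Y = (\<Sum>k\<in>S. a k * f (X k))"
    using insert.prems by (intro insert.IH) simp
  finally show ?case by (simp only: sum.insert[OF insert.hyps] mult_1)
qed

lemma linear_functional_expand:
  assumes f: "linear_functional d f" and X: "X \<in> carrier_mat d d"
  shows "f X = (\<Sum>(i, j)\<in>{..<d} \<times> {..<d}. X $$ (i, j) * f (outer d (unit_fun i) (unit_fun j)))"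
proof -
  have "X = mat d d (\<lambda>(r, c). \<Sum>k\<in>{..<d} \<times> {..<d}. X $$ k * outer d (unit_fun (fst k)) (unit_fun (snd k)) $$ (r, c))"
  proof (rule eq_matI; simp add: X[THEN carrier_matD(1)] X[THEN carrier_matD(2)])
    fix r c assume rc: "r < d" "c < d"
    have "(\<Sum>k\<in>{..<d} \<times> {..<d}. X $$ k * outer d (unit_fun (fst k)) (unit_fun (snd k)) $$ (r, c))
      = (\<Sum>k\<in>{..<d} \<times> {..<d}. if k = (r, c) then X $$ k else 0)"
      using rc by (intro sum.cong) (auto simp: outer_def unit_fun_def)
    also have "\<dots> = X $$ (r, c)" using rc by simp
    finally show "X $$ (r, c) = (\<Sum>k\<in>{..<d} \<times> {..<d}. X $$ k * outer d (unit_fun (fst k)) (unit_fun (snd k)) $$ (r, c))" ..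
  qed
  then have "f X = f \<dots>" by (rule arg_cong)
  also have "\<dots> = (\<Sum>k\<in>{..<d} \<times> {..<d}. X $$ k * f (outer d (unit_fun (fst k)) (unit_fun (snd k))))"
    by (rule linear_functional_sum[OF f]) auto
  finally show ?thesis by (simp add: case_prod_unfold)
qed

text \<open>The arguments are swapped because \<open>outer d v w\<close> is antilinear in w, which
  must come first.\<close>

lemma sesquilinear_functional_outer:
  assumes "linear_functional d f"
  shows "sesquilinear (\<lambda>w v. f (outer d v w))"
proof -
  have "outer d (\<lambda>i. a * x i + b * y i) z = a \<cdot>\<^sub>m outer d x z + b \<cdot>\<^sub>m outer d y z"
    "outer d z (\<lambda>i. a * x i + b * y i) = cnj a \<cdot>\<^sub>m outer d z x + cnj b \<cdot>\<^sub>m outer d z y" for a b x y z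
    by (rule eq_matI; simp add: outer_def algebra_simps)+
  then show ?thesis
    unfolding sesquilinear_def by (simp add: linear_functionalD[OF assms])
qed

text \<open>On matrix units f is 0 off the diagonal and constant on it, so only the trace of X
  survives.\<close>

lemma functional_scalar_imp_trace:
  assumes f: "linear_functional d f" and h: "\<And>x. proportional_at (\<lambda>w v. f (outer d v w)) (sdot d) x"
    and X: "X \<in> carrier_mat d d"
  shows "f X = mat_trace X * f (outer d (unit_fun 0) (unit_fun 0))"
proof -
  define c where "c = f (outer d (unit_fun 0) (unit_fun 0))"
  have e: "f (outer d (unit_fun i) (unit_fun j)) = (if j = i then c else 0)" if "i < d" "j < d" for i j
    unfolding c_def
    by (rule proportional_sdot_imp_scalar[OF sesquilinear_functional_outer[OF f] h that(2,1)])
  have "f X = (\<Sum>i<d. \<Sum>j<d. X $$ (i, j) * f (outer d (unit_fun i) (unit_fun j)))"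
    using linear_functional_expand[OF f X] by (simp add: sum.cartesian_product)
  also have "\<dots> = (\<Sum>i<d. \<Sum>j<d. if j = i then X $$ (i, j) * c else 0)"
    by (intro sum.cong refl) (simp add: e)
  also have "\<dots> = mat_trace X * c"
    using X by (simp add: mat_trace_def sum_distrib_right)
  finally show ?thesis by (simp only: c_def)
qed

lemma mat_scalar_if_proportional:
  assumes A: "A \<in> carrier_mat d d" and h: "\<And>x. proportional_at (\<lambda>w v. sdot d w (app d A v)) (sdot d) x"
    and tr: "mat_trace A = 1"
  shows "A = (1 / of_nat d) \<cdot>\<^sub>m 1\<^sub>m d"
proof -
  define c where "c = A $$ (0, 0)"
  have e: "A $$ (i, j) = (if i = j then c else 0)" if "i < d" "j < d" for i j
    unfolding c_def
    using proportional_sdot_imp_scalar[OF sesquilinear_sdot_app h that] that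
    by (simp add: sdot_unit app_unit)
  have "mat_trace A = of_nat d * c"
    using A e by (simp add: mat_trace_def)
  \<comment> \<open>A trace equal to 1 excludes d = 0, which makes the division legitimate.\<close>
  with tr have "c = 1 / of_nat d"
    by (metis mult_zero_left nonzero_mult_div_cancel_left zero_neq_one)
  with e A show ?thesis by (intro eq_matI) auto
qed

lemma linear_functional_superop:
  assumes E: "linear_superop dA dB E"
  shows "linear_functional dA (\<lambda>X. sdot dB w (app dB (E X) w))"
proof -
  have "app dB (a \<cdot>\<^sub>m X + b \<cdot>\<^sub>m Y) w i = a * app dB X w i + b * app dB Y w i"
    if "X \<in> carrier_mat dB dB" "Y \<in> carrier_mat dB dB" "i < dB" for a b X Y i
    using that by (simp add: app_def sum.distrib sum_distrib_left algebra_simps)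
  with E show ?thesis
    by (simp add: linear_functional_def linear_superop_def sdot_def sum.distrib sum_distrib_left algebra_simps)
qed

section \<open>Two-outcome measurements of a ray\<close>

lemma smult_outer_mult_smult_outer:
  "(a \<cdot>\<^sub>m outer d p q) * (b \<cdot>\<^sub>m outer d v w) = (a * b * sdot d q v) \<cdot>\<^sub>m outer d p w"
proof -
  have "(a \<cdot>\<^sub>m outer d p q) * (b \<cdot>\<^sub>m outer d v w) = a \<cdot>\<^sub>m (b \<cdot>\<^sub>m (outer d p q * outer d v w))"
    by (subst mult_smult_assoc_mat[of _ d d _ d], simp, simp)
      (subst mult_smult_distrib[of _ d d _ d], simp_all)
  also have "\<dots> = (a * b * sdot d q v) \<cdot>\<^sub>m outer d p w"
    unfolding outer_mult_outer by (rule eq_matI) simp_all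
  finally show ?thesis .
qed

text \<open>Leaving v unnormalised makes the NSIT identity polynomial in v and its conjugate once
  denominators are cleared, ready for polarisation.\<close>

definition ray_measurement :: "nat \<Rightarrow> (nat \<Rightarrow> complex) \<Rightarrow> nat \<Rightarrow> complex mat" where
  "ray_measurement d v i =
     (let P = (1 / sdot d v v) \<cdot>\<^sub>m outer d v v in if i = 0 then P else 1\<^sub>m d - P)"

lemma projective_measurement_ray:
  assumes v: "sdot d v v \<noteq> 0"
  shows "projective_measurement d 2 (ray_measurement d v)"
proof -
  define P where "P = (1 / sdot d v v) \<cdot>\<^sub>m outer d v v"
  have P: "P \<in> carrier_mat d d" by (simp add: P_def)
  have "cnj (sdot d v v) = sdot d v v" by (simp add: sdot_def mult.commute)
  then have h: "mat_adjoint P = P"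
    by (intro eq_matI) (auto simp: P_def mat_adjoint_def mat_of_rows_def outer_def mult.commute)
  have h': "mat_adjoint (1\<^sub>m d - P) = 1\<^sub>m d - P"
  proof (rule eq_matI)
    fix i j assume ij: "i < dim_row (1\<^sub>m d - P)" "j < dim_col (1\<^sub>m d - P)"
    then have "cnj (P $$ (j, i)) = P $$ (i, j)"
      using arg_cong[OF h, of "\<lambda>M. M $$ (i, j)"] P by (auto simp: mat_adjoint_def mat_of_rows_def)
    then show "mat_adjoint (1\<^sub>m d - P) $$ (i, j) = (1\<^sub>m d - P) $$ (i, j)"
      using ij P by (auto simp: mat_adjoint_def mat_of_rows_def)
  qed (use P in \<open>auto simp: mat_adjoint_def mat_of_rows_def\<close>)
  have PP: "P * P = P"
    unfolding P_def smult_outer_mult_smult_outer using v by simp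
  have PQ: "P * (1\<^sub>m d - P) = 0\<^sub>m d d" "(1\<^sub>m d - P) * P = 0\<^sub>m d d"
    using P PP by (simp_all add: mult_minus_distrib_mat[of _ d d _ d] minus_mult_distrib_mat[of _ d d _ _ d])
  have "(1\<^sub>m d - P) * (1\<^sub>m d - P) = (1\<^sub>m d - P) * 1\<^sub>m d - (1\<^sub>m d - P) * P"
    using P by (intro mult_minus_distrib_mat[of _ d d _ d] minus_carrier_mat) simp_all
  then have QQ: "(1\<^sub>m d - P) * (1\<^sub>m d - P) = 1\<^sub>m d - P"
    unfolding PQ using P by (simp add: right_mult_one_mat[OF minus_carrier_mat[OF P]]) (rule eq_matI; simp)
  show ?thesis
    unfolding projective_measurement_def ray_measurement_def P_def[symmetric] Let_def hermitian_mat_def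
  proof (intro conjI allI impI)
    have "(\<Sum>i<2::nat. (if i = 0 then P else 1\<^sub>m d - P) $$ (r, c)) = 1\<^sub>m d $$ (r, c)"
      if "r < d" "c < d" for r c
      using that P by (simp add: numeral_2_eq_2)
    then show "mat d d (\<lambda>(r, c). \<Sum>i<2::nat. (if i = 0 then P else 1\<^sub>m d - P) $$ (r, c)) = 1\<^sub>m d"
      by (intro eq_matI) simp_all
  next
    fix i j :: nat assume "i < 2" "j < 2"
    then show "(if i = 0 then P else 1\<^sub>m d - P) * (if j = 0 then P else 1\<^sub>m d - P) =
        (if i = j then (if i = 0 then P else 1\<^sub>m d - P) else 0\<^sub>m d d)"
      using PP PQ QQ by (auto simp: less_2_cases_iff)
  qed (use P h h' in \<open>auto intro: minus_carrier_mat\<close>)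
qed

text \<open>With P the projection onto v, the two outcomes sum to A - PA - AP + 2 PAP, so invariance
  says 2 f(PAP) = f(PA) + f(AP). Moreover PAP is a multiple of \<open>outer d v v\<close>.\<close>

lemma functional_ray_dephasing:
  assumes f: "linear_functional d f" and A: "A \<in> carrier_mat d d" and v: "sdot d v v \<noteq> 0"
    and h: "(\<Sum>i<2. f (ray_measurement d v i * A * ray_measurement d v i)) = f A"
  shows "2 * sdot d v (app d A v) * f (outer d v v) =
    sdot d v v * (f (outer d v v * A) + f (A * outer d v v))"
proof -
  define P where "P = (1 / sdot d v v) \<cdot>\<^sub>m outer d v v"
  have P: "P \<in> carrier_mat d d" by (simp add: P_def)
  note c = mult_carrier_mat[of _ d d _ d]
  have PA: "P * A = (1 / sdot d v v) \<cdot>\<^sub>m (outer d v v * A)"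
    using A by (simp add: P_def mult_smult_assoc_mat[of _ d d _ d])
  have AP: "A * P = (1 / sdot d v v) \<cdot>\<^sub>m (A * outer d v v)"
    using A by (simp add: P_def mult_smult_distrib[of _ d d _ d])
  have "P * A * P = P * (A * P)" by (rule assoc_mult_mat[OF P A P])
  also have "\<dots> = (sdot d v (app d A v) / (sdot d v v)\<^sup>2) \<cdot>\<^sub>m outer d v v"
    unfolding AP unfolding P_def mult_outer[OF A] smult_outer_mult_smult_outer
    by (simp add: power2_eq_square)
  finally have PAP: "P * A * P = (sdot d v (app d A v) / (sdot d v v)\<^sup>2) \<cdot>\<^sub>m outer d v v" .
  have "(1\<^sub>m d - P) * A = A - P * A"
    using P A by (simp add: minus_mult_distrib_mat[of _ d d _ _ d])
  moreover have "(A - P * A) * (1\<^sub>m d - P) = (A - P * A) * 1\<^sub>m d - (A - P * A) * P"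
    using P A c by (intro mult_minus_distrib_mat[of _ d d _ d] minus_carrier_mat) simp_all
  moreover have "(A - P * A) * 1\<^sub>m d = A - P * A"
    using P A c by (intro right_mult_one_mat minus_carrier_mat)
  moreover have "(A - P * A) * P = A * P - P * A * P"
    using P A c by (intro minus_mult_distrib_mat[of _ d d _ _ d])
  ultimately have "(1\<^sub>m d - P) * A * (1\<^sub>m d - P) = (A - P * A) - (A * P - P * A * P)"
    by (simp only:)
  moreover have "f ((A - P * A) - (A * P - P * A * P)) = f A - f (P * A) - (f (A * P) - f (P * A * P))"
    using P A c by (simp add: linear_functional_minus[OF f] minus_carrier_mat[of _ d d])
  ultimately have "f (P * A * P) + (f A - f (P * A) - (f (A * P) - f (P * A * P))) = f A"
    using h by (simp add: ray_measurement_def P_def[symmetric] numeral_2_eq_2)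
  moreover have "2 * f (P * A * P) - (f (P * A) + f (A * P)) =
      f (P * A * P) + (f A - f (P * A) - (f (A * P) - f (P * A * P))) - f A"
    by simp
  ultimately have "2 * f (P * A * P) = f (P * A) + f (A * P)"
    by simp
  moreover have "f (P * A * P) = sdot d v (app d A v) / (sdot d v v)\<^sup>2 * f (outer d v v)"
    unfolding PAP by (rule linear_functional_smult[OF f]) simp
  moreover have "f (P * A) = f (outer d v v * A) / sdot d v v" "f (A * P) = f (A * outer d v v) / sdot d v v"
    unfolding PA AP
    using linear_functional_smult[OF f c[OF outer_carrier A]] linear_functional_smult[OF f c[OF A outer_carrier]]
    by simp_all
  ultimately show ?thesis
    using v by (simp add: field_simps power2_eq_square)
qed

text \<open>Supplies the fourth sesquilinear form of the polarisation.\<close>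

lemma linear_functional_anticommutator:
  assumes f: "linear_functional d f" and A: "A \<in> carrier_mat d d"
  shows "linear_functional d (\<lambda>X. f (X * A) + f (A * X))"
  unfolding linear_functional_def
proof (intro allI ballI)
  fix a b and X Y :: "complex mat" assume XY: "X \<in> carrier_mat d d" "Y \<in> carrier_mat d d"
  have "(a \<cdot>\<^sub>m X + b \<cdot>\<^sub>m Y) * A = a \<cdot>\<^sub>m (X * A) + b \<cdot>\<^sub>m (Y * A)"
    using XY A by (simp add: add_mult_distrib_mat[of _ d d _ _ d] mult_smult_assoc_mat[of _ d d _ d])
  moreover have "A * (a \<cdot>\<^sub>m X + b \<cdot>\<^sub>m Y) = a \<cdot>\<^sub>m (A * X) + b \<cdot>\<^sub>m (A * Y)"
    using XY A by (simp add: mult_add_distrib_mat[of _ d d _ d] mult_smult_distrib[of _ d d _ d])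
  ultimately show "f ((a \<cdot>\<^sub>m X + b \<cdot>\<^sub>m Y) * A) + f (A * (a \<cdot>\<^sub>m X + b \<cdot>\<^sub>m Y)) =
      a * (f (X * A) + f (A * X)) + b * (f (Y * A) + f (A * Y))"
    using XY A by (simp add: linear_functionalD[OF f] algebra_simps mult_carrier_mat[of _ d d _ d])
qed

lemma dephasing_invariant_functional:
  assumes f: "linear_functional d f" and A: "A \<in> carrier_mat d d"
    and h: "\<And>v. sdot d v v \<noteq> 0 \<Longrightarrow>
      (\<Sum>i<2. f (ray_measurement d v i * A * ray_measurement d v i)) = f A"
  shows "(\<forall>x. proportional_at (\<lambda>w v. sdot d w (app d A v)) (sdot d) x) \<or>
    (\<forall>x. proportional_at (\<lambda>w v. f (outer d v w)) (sdot d) x)"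
proof -
  note sesq = sesquilinear_sdot_app[of d A] sesquilinear_functional_outer[OF f] sesquilinear_sdot[of d]
  \<comment> \<open>Polarisation inserts arbitrary combinations, so the identity must also cover
    null vectors; those vanish below d and make both sides 0.\<close>
  have pol: "2 * sdot d v (app d A v) * f (outer d v v) =
    sdot d v v * (f (outer d v v * A) + f (A * outer d v v))" for v
  proof (cases "sdot d v v = 0")
    case True
    then have "sdot d v (app d A v) = 0"
      using sdot_self_eq_0[OF True] by (simp add: sdot_def)
    with True show ?thesis by simp
  qed (rule functional_ray_dephasing[OF f A _ h])
  have "2 * sdot d y (app d A x) * f (outer d x y) =
    sdot d y x * (f (outer d x y * A) + f (A * outer d x y))" for x y
    by (rule sesquilinear_polarize[OF sesq sesquilinear_functional_outer[OF
        linear_functional_anticommutator[OF f A]] pol])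
  then have "sdot d y (app d A x) * f (outer d x y) = 0" if "sdot d y x = 0" for x y
    using that by (metis mult_eq_0_iff zero_neq_numeral)
  then show ?thesis
    by (intro globally_proportional[OF sesq] pointwise_proportional[OF sesq])
qed

section \<open>Channels and the dichotomy for states\<close>

text \<open>Turns complete positivity at k = 1 into positivity of E itself.\<close>

lemma id_tensor_1:
  assumes "X \<in> carrier_mat dA dA" "E X \<in> carrier_mat dB dB"
  shows "id_tensor 1 dA dB E X = E X"
proof -
  have "mat_block dA X 0 0 = X"
    using assms by (intro eq_matI) (auto simp: mat_block_def)
  then show ?thesis
    using assms by (intro eq_matI) (auto simp: id_tensor_def)
qed

lemma state_carrier: "state d \<rho> \<Longrightarrow> \<rho> \<in> carrier_mat d d"
  by (simp add: state_def psd_mat_def hermitian_mat_def)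

lemma quantum_channel_state:
  assumes E: "quantum_channel dA dB E" and \<rho>: "state dA \<rho>"
  shows "state dB (E \<rho>)"
proof -
  note c = state_carrier[OF \<rho>]
  have "psd_mat (1 * dB) (id_tensor 1 dA dB E \<rho>)"
    using E \<rho> unfolding quantum_channel_def completely_positive_def state_def
    by (metis mult_1)
  moreover have "id_tensor 1 dA dB E \<rho> = E \<rho>"
    using E c by (intro id_tensor_1) (auto simp: quantum_channel_def linear_superop_def)
  ultimately show ?thesis
    using E \<rho> c by (simp add: state_def quantum_channel_def trace_preserving_def)
qed

theorem theorem1:
  fixes dA dB :: nat
    and \<rho> :: "complex mat"
    and E :: "complex mat \<Rightarrow> complex mat"
  assumes "dA > 1"
    and "state dA \<rho>"
    and "quantum_channel dA dB E"
    and "\<And>m P n Q. projective_measurement dA m P \<Longrightarrow> projective_measurement dB n Q \<Longrightarrow> nsit \<rho> E m P n Q"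
  shows "\<rho> = (1 / of_nat dA) \<cdot>\<^sub>m 1\<^sub>m dA \<or> discard_and_prepare dA dB E"
proof (rule disj_imp[THEN iffD2], rule impI)
  assume nonscalar: "\<rho> \<noteq> (1 / of_nat dA) \<cdot>\<^sub>m 1\<^sub>m dA"
  have \<rho>: "\<rho> \<in> carrier_mat dA dA" "mat_trace \<rho> = 1"
    using assms(2) state_carrier by (auto simp: state_def)
  have E: "linear_superop dA dB E" using assms(3) by (simp add: quantum_channel_def)
  then have EC: "E X \<in> carrier_mat dB dB" if "X \<in> carrier_mat dA dA" for X
    using that by (simp add: linear_superop_def)
  define f where "f = (\<lambda>w X. sdot dB w (app dB (E X) w))"
  have f: "linear_functional dA (f w)" for w
    unfolding f_def by (rule linear_functional_superop[OF E])
  have f_eq: "f w \<omega> = f w \<rho>" if "state dA \<omega>" for w \<omega>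
  \<comment> \<open>A null w spans no ray to measure, but then \<open>f w\<close> is identically
    0.\<close>
  proof (cases "sdot dB w w = 0")
    case True
    then have "f w X = 0" for X
      using sdot_self_eq_0[OF True] by (simp add: f_def sdot_def)
    then show ?thesis by simp
  next
    case False
    \<comment> \<open>Outcome 0 of the ray measurement of w reads off \<open>f w\<close> up to
      normalisation, so NSIT becomes an invariance of \<open>f w\<close>.\<close>
    have trace_eq: "mat_trace (E X * ray_measurement dB w 0) = f w X / sdot dB w w"
      if "X \<in> carrier_mat dA dA" for X
    proof -
      have "E X * ray_measurement dB w 0 = (1 / sdot dB w w) \<cdot>\<^sub>m outer dB (app dB (E X) w) w"
        using EC[OF that] by (simp add: ray_measurement_def mult_smult_distrib[of _ dB dB _ dB] mult_outer)
      then show ?thesis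
        by (simp add: f_def mat_trace_def outer_def sdot_def sum_divide_distrib mult.commute)
    qed
    have "(\<Sum>i<2. f w (ray_measurement dA v i * \<rho> * ray_measurement dA v i)) = f w \<rho>"
      if v: "sdot dA v v \<noteq> 0" for v
    proof -
      have c: "ray_measurement dA v i * \<rho> * ray_measurement dA v i \<in> carrier_mat dA dA" for i
        using \<rho> by (auto simp: ray_measurement_def Let_def intro!: mult_carrier_mat[of _ dA dA _ dA] minus_carrier_mat)
      have "(\<Sum>i<2. mat_trace (E (ray_measurement dA v i * \<rho> * ray_measurement dA v i) * ray_measurement dB w 0))
          = mat_trace (E \<rho> * ray_measurement dB w 0)"
        using assms(4)[OF projective_measurement_ray[OF v] projective_measurement_ray[OF False]]
        unfolding nsit_def by (metis zero_less_numeral)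
      then show ?thesis
        unfolding trace_eq[OF c] trace_eq[OF \<rho>(1)]
        using False by (simp add: sum_divide_distrib[symmetric])
    qed
    \<comment> \<open>The first alternative concerns \<rho> alone and would make it maximally mixed;
      hence the second holds whatever w is.\<close>
    from dephasing_invariant_functional[OF f \<rho>(1) this]
    have "proportional_at (\<lambda>u v. f w (outer dA v u)) (sdot dA) x" for x
      using mat_scalar_if_proportional[OF \<rho>(1) _ \<rho>(2)] nonscalar by blast
    \<comment> \<open>\<open>f w\<close> is a multiple of the trace, and all states have trace
      1.\<close>
    from functional_scalar_imp_trace[OF f this] that \<rho>
    show ?thesis by (metis state_def state_carrier)
  qed
  have "E \<omega> = E \<rho>" if "state dA \<omega>" for \<omega>
    using f_eq[OF that] EC[OF state_carrier[OF that]] EC[OF \<rho>(1)]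
    unfolding f_def by (rule_tac mat_eq_if_quadratic_forms_eq)
  \<comment> \<open>The prepared state is \<open>E \<rho>\<close>.\<close>
  with quantum_channel_state[OF assms(3,2)] assms(3) show "discard_and_prepare dA dB E"
    by (auto simp: discard_and_prepare_def)
qed

end
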